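(* The modal logic $12$g is strongly complete for the class of all non-degenerate projective $1$-planes: every $12$g-consistent set of modal formulas is satisfiable in some model on some non-degenerate projective $1$-plane.
   Context: Modal formulas are built from countably many propositional variables with $\neg,\wedge,\Box$; $\Diamond=\neg\Box\neg$, $\Box^n$ is $n$-fold $\Box$. A $1$-frame is $(X,I)$ with $I\subseteq X\times X$; a model is a $1$-frame with a valuation $V$ assigning to each variable a subset of $X$; truth at a point is defined as usual, with $\Box\varphi$ true at $a$ iff $\varphi$ is true at all $b$ with $aIb$. A set of formulas is satisfiable in a model if all its members are true at some common point. A normal logic is a set of formulas containing all tautologies and all instances of $\Box(\varphi\to\psi)\to(\Box\varphi\to\Box\psi)$, closed under modus ponens and the rule from $\varphi$ infer $\Box\varphi$. $12$g is the smallest normal logic containing all instances of $\Box\varphi\to\Diamond\varphi$, $\Diamond\Box\varphi\to\varphi$, and $\Box\Box\varphi\to\Box\Box\Box\Box\varphi$. A set $\Sigma$ is $\Lambda$-consistent if for no finite conjunction $\varphi$ of members of $\Sigma$ is $\neg\varphi\in\Lambda$. A $1$-plane is a $1$-frame satisfying O1: $aI^4b$ implies $aI^2b$; O2: for all $a,b$, $aI^2b$ or $aI^3b$; O3: $aIbIcIdIa$ implies $a=c$ or $b=d$ (here $I^n$ is $n$-fold composition). In a $1$-plane $I^2$ is an equivalence relation; the plane is projective if it has exactly two $I^2$-classes, and non-degenerate if O4 holds: there exist $a,b,c,d,e,f$ with $aIbIcId$ and $eIf$, not $aId$, and none of $a,b,c,d$ incident with $e$ or $f$. *)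

theory Defs imports Main begin

datatype fm = Var nat | Neg fm | And fm fm | Box fm

abbreviation Imp :: "fm \<Rightarrow> fm \<Rightarrow> fm" where
  "Imp p q \<equiv> Neg (And p (Neg q))"

abbreviation Dia :: "fm \<Rightarrow> fm" where
  "Dia p \<equiv> Neg (Box (Neg p))"

text \<open>Tautologies are tautologies in the modal language: variables and boxed formulas
  both count as propositional atoms.\<close>

primrec bool_eval :: "(fm \<Rightarrow> bool) \<Rightarrow> fm \<Rightarrow> bool" where
  "bool_eval v (Var n) = v (Var n)"
| "bool_eval v (Neg p) = (\<not> bool_eval v p)"
| "bool_eval v (And p q) = (bool_eval v p \<and> bool_eval v q)"
| "bool_eval v (Box p) = v (Box p)"

definition tautology :: "fm \<Rightarrow> bool" where
  "tautology p \<longleftrightarrow> (\<forall>v. bool_eval v p)"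

definition normal_logic :: "fm set \<Rightarrow> bool" where
  "normal_logic L \<longleftrightarrow>
     (\<forall>p. tautology p \<longrightarrow> p \<in> L) \<and>
     (\<forall>p q. Imp (Box (Imp p q)) (Imp (Box p) (Box q)) \<in> L) \<and>
     (\<forall>p q. Imp p q \<in> L \<longrightarrow> p \<in> L \<longrightarrow> q \<in> L) \<and>
     (\<forall>p. p \<in> L \<longrightarrow> Box p \<in> L)"

definition logic_12g :: "fm set" where
  "logic_12g = \<Inter> {L. normal_logic L \<and>
     (\<forall>p. Imp (Box p) (Dia p) \<in> L) \<and>
     (\<forall>p. Imp (Dia (Box p)) p \<in> L) \<and>
     (\<forall>p. Imp (Box (Box p)) (Box (Box (Box (Box p)))) \<in> L)}"

text \<open>Finite nonempty conjunctions, in any order and bracketing, repetitions allowed.\<close>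

inductive_set conjunctions :: "fm set \<Rightarrow> fm set" for \<Sigma> :: "fm set" where
  member: "p \<in> \<Sigma> \<Longrightarrow> p \<in> conjunctions \<Sigma>"
| conj: "p \<in> conjunctions \<Sigma> \<Longrightarrow> q \<in> conjunctions \<Sigma> \<Longrightarrow> And p q \<in> conjunctions \<Sigma>"

definition consistent :: "fm set \<Rightarrow> fm set \<Rightarrow> bool" where
  "consistent L \<Sigma> \<longleftrightarrow> (\<forall>p \<in> conjunctions \<Sigma>. Neg p \<notin> L)"

definition frame :: "'a set \<Rightarrow> ('a \<times> 'a) set \<Rightarrow> bool" where
  "frame X I \<longleftrightarrow> I \<subseteq> X \<times> X"

definition valuation :: "'a set \<Rightarrow> (nat \<Rightarrow> 'a set) \<Rightarrow> bool" where
  "valuation X V \<longleftrightarrow> (\<forall>n. V n \<subseteq> X)"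

primrec true_at :: "('a \<times> 'a) set \<Rightarrow> (nat \<Rightarrow> 'a set) \<Rightarrow> 'a \<Rightarrow> fm \<Rightarrow> bool" where
  "true_at I V a (Var n) = (a \<in> V n)"
| "true_at I V a (Neg p) = (\<not> true_at I V a p)"
| "true_at I V a (And p q) = (true_at I V a p \<and> true_at I V a q)"
| "true_at I V a (Box p) = (\<forall>b. (a, b) \<in> I \<longrightarrow> true_at I V b p)"

definition satisfiable_in ::
  "'a set \<Rightarrow> ('a \<times> 'a) set \<Rightarrow> (nat \<Rightarrow> 'a set) \<Rightarrow> fm set \<Rightarrow> bool" where
  "satisfiable_in X I V \<Sigma> \<longleftrightarrow> (\<exists>a\<in>X. \<forall>p\<in>\<Sigma>. true_at I V a p)"

text \<open>Symmetry of \<open>I\<close> is not required explicitly; it follows from the three conditions.\<close>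

definition one_plane :: "'a set \<Rightarrow> ('a \<times> 'a) set \<Rightarrow> bool" where
  "one_plane X I \<longleftrightarrow> frame X I \<and>
     (\<forall>a b. (a, b) \<in> I ^^ 4 \<longrightarrow> (a, b) \<in> I ^^ 2) \<and>
     (\<forall>a\<in>X. \<forall>b\<in>X. (a, b) \<in> I ^^ 2 \<or> (a, b) \<in> I ^^ 3) \<and>
     (\<forall>a b c d. (a, b) \<in> I \<and> (b, c) \<in> I \<and> (c, d) \<in> I \<and> (d, a) \<in> I \<longrightarrow> a = c \<or> b = d)"

lemma one_plane_sym:
  assumes "one_plane X I" "(a, b) \<in> I"
  shows "(b, a) \<in> I"
proof -
  have 4: "I ^^ 4 \<subseteq> I ^^ 2"
    using assms(1) unfolding one_plane_def by auto
  have X: "a \<in> X" "b \<in> X"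
    using assms unfolding one_plane_def frame_def by blast+
  have 2: "(c, d) \<in> I ^^ 2 \<or> (c, d) \<in> I ^^ 3" if "c \<in> X" "d \<in> X" for c d
    using assms(1) that unfolding one_plane_def by blast
  have 3: "a = c \<or> b = d" if "(b, c) \<in> I" "(c, d) \<in> I" "(d, a) \<in> I" for c d
    using assms that unfolding one_plane_def by blast
  have p2: "I ^^ 2 = I O I" and p3: "I ^^ 3 = I O I O I"
    and p4: "I ^^ 4 = I O I O I O I"
    by (simp_all add: numeral_eq_Suc O_assoc)
  have 5: "I O I O I O I O I \<subseteq> I O I O I"
    using 4 unfolding p2 p4 by blast
  have "(b, a) \<in> I ^^ 3"
    using 2[OF X(2,1)]
  proof
    assume "(b, a) \<in> I ^^ 2"
    then have "(b, a) \<in> I O I O I O I O I"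
      using assms(2) unfolding p2 by blast
    then show ?thesis using 5 unfolding p3 by blast
  qed
  then obtain p q where "(b, p) \<in> I" "(p, q) \<in> I" "(q, a) \<in> I"
    unfolding p3 by blast
  with 3 assms(2) show ?thesis by metis
qed

lemma one_plane_equiv:
  assumes "one_plane X I"
  shows "equiv X (I ^^ 2)"
proof (rule equivI)
  have p2: "I ^^ 2 = I O I" and p3: "I ^^ 3 = I O I O I"
    and p4: "I ^^ 4 = I O I O I O I"
    by (simp_all add: numeral_eq_Suc O_assoc)
  have s: "(b, a) \<in> I" if "(a, b) \<in> I" for a b
    using one_plane_sym[OF assms that] .
  show "I ^^ 2 \<subseteq> X \<times> X"
    using assms unfolding one_plane_def frame_def p2 by blast
  show "refl_on X (I ^^ 2)"
  proof (rule refl_onI)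
    fix a assume "a \<in> X"
    then have "\<exists>b. (a, b) \<in> I"
      using assms unfolding one_plane_def p2 p3 by blast
    then show "(a, a) \<in> I ^^ 2" unfolding p2 using s by blast
  qed
  show "sym (I ^^ 2)" unfolding p2 by (rule symI, use s in blast)
  show "trans (I ^^ 2)"
  proof (rule transI)
    fix a b c assume "(a, b) \<in> I ^^ 2" "(b, c) \<in> I ^^ 2"
    then have "(a, c) \<in> I ^^ 4" unfolding p2 p4 by blast
    then show "(a, c) \<in> I ^^ 2" using assms unfolding one_plane_def by blast
  qed
qed

definition projective :: "'a set \<Rightarrow> ('a \<times> 'a) set \<Rightarrow> bool" where
  "projective X I \<longleftrightarrow> card (X // (I ^^ 2)) = 2"

definition nondegenerate :: "('a \<times> 'a) set \<Rightarrow> bool" where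
  "nondegenerate I \<longleftrightarrow> (\<exists>a b c d e f.
     (a, b) \<in> I \<and> (b, c) \<in> I \<and> (c, d) \<in> I \<and> (e, f) \<in> I \<and> (a, d) \<notin> I \<and>
     (\<forall>x\<in>{a, b, c, d}. \<forall>y\<in>{e, f}. (x, y) \<notin> I))"

end

theory Submission
  imports Defs "HOL-Library.Countable"
begin

text \<open>The canonical frame of \<open>12g\<close> is serial and symmetric, and satisfies \<open>R\<^sup>4 \<subseteq> R\<^sup>2\<close>; hence
  \<open>R\<^sup>2\<close> is an equivalence relation on it. A plane is built freely over it: the vertices are the natural
  numbers, even ones being points and odd ones lines, and every vertex carries a maximal consistent
  set, with incident vertices carrying \<open>R\<close>-related sets. A new vertex is attached either to a single
  old vertex, in order to provide a witness for a formula \<open>\<diamond>p\<close>, or to two old vertices of the same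
  kind without a common neighbour. In the second case a label is available because the labels of
  vertices of one kind stay inside one \<open>R\<^sup>2\<close>-class. Neither step creates a 4-cycle, and the initial
  configuration witnessing non-degeneracy survives since no incidence between old vertices is added.\<close>

section \<open>Labelled free planes\<close>

text \<open>\<open>f n\<close> consists of the label of vertex \<open>n\<close> and the set of its neighbours below \<open>n\<close>.\<close>

definition earlier_adj :: "(nat \<Rightarrow> 'w \<times> nat set) \<Rightarrow> nat \<Rightarrow> nat \<Rightarrow> bool" where
  "earlier_adj f i j \<longleftrightarrow> i \<in> snd (f j) \<or> j \<in> snd (f i)"

lemma earlier_adj_sym: "earlier_adj f i j \<longleftrightarrow> earlier_adj f j i"
  by (auto simp: earlier_adj_def)

definition unjoined :: "(nat \<Rightarrow> 'w \<times> nat set) \<Rightarrow> nat \<Rightarrow> nat \<Rightarrow> nat \<Rightarrow> bool" where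
  "unjoined f n i k \<longleftrightarrow> (\<forall>m<n. \<not> (earlier_adj f i m \<and> earlier_adj f k m))"

text \<open>At stage \<open>n\<close> with task \<open>(i, k)\<close>, the number \<open>k\<close> is read as a vertex to be joined to \<open>i\<close> if
  this is possible, and as the index of a witness demanded by \<open>i\<close> otherwise. Since every task recurs
  and a joined pair stays joined, both readings are eventually served.\<close>

definition task :: "nat \<Rightarrow> nat \<times> nat" where
  "task n = prod_decode (fst (prod_decode (n div 2)))"

text \<open>Halving leaves the parity of the stage free, and the discarded second component of the
  outer pair makes every task recur.\<close>

lemma task_unbounded: "\<exists>n>N. even n = e \<and> task n = (i, k)"
proof -
  let ?m = "prod_encode (prod_encode (i, k), Suc N)"
  let ?n = "2 * ?m + (if e then 0 else 1)"
  have "Suc N \<le> ?m" by (rule le_prod_encode_2)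
  then show ?thesis
    by (intro exI[of _ ?n]) (auto simp: task_def)
qed

text \<open>The path 0-1-2-3 and the edge 4-5 witness non-degeneracy.\<close>

definition initial_nbrs :: "nat \<Rightarrow> nat set" where
  "initial_nbrs n = (if n = 0 \<or> n = 4 then {} else {n - 1})"

text \<open>\<open>R\<close> abstracts the canonical relation, and \<open>D w k\<close> the
  \<open>k\<close>-th demanded successor of \<open>w\<close>. The law for \<open>D\<close> is
  conditional because the type of labels may contain elements without successors.\<close>

locale labelled_plane =
  fixes R :: "'w rel" and D :: "'w \<Rightarrow> nat \<Rightarrow> 'w" and w0 w1 :: 'w
  assumes sym: "(x, y) \<in> R \<Longrightarrow> (y, x) \<in> R"
    and four: "(a, b) \<in> R \<Longrightarrow> (b, c) \<in> R \<Longrightarrow> (c, d) \<in> R \<Longrightarrow> (d, e) \<in> R \<Longrightarrow>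
      \<exists>x. (a, x) \<in> R \<and> (x, e) \<in> R"
    and D: "(w, v) \<in> R \<Longrightarrow> (w, D w k) \<in> R"
    and w01: "(w0, w1) \<in> R"
begin

text \<open>All labels of vertices with the parity of \<open>n\<close> are confined to the
  \<open>R^2\<close>-class of \<open>base n\<close>.\<close>

definition base :: "nat \<Rightarrow> 'w" where
  "base n = (if even n then w0 else w1)"

text \<open>A relation, not a function, since the label of a joining vertex is merely known to
  exist. The third clause excludes 4-cycles. A task whose \<open>i\<close> is not below
  \<open>n\<close> or has the parity of \<open>n\<close> demands nothing.\<close>

definition admissible :: "(nat \<Rightarrow> 'w \<times> nat set) \<Rightarrow> nat \<Rightarrow> 'w \<times> nat set \<Rightarrow> bool" where
  "admissible f n r \<longleftrightarrow>
     (\<exists>x. (base n, x) \<in> R \<and> (x, fst r) \<in> R) \<and>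
     (\<forall>j\<in>snd r. j < n \<and> even j \<noteq> even n \<and> (fst (f j), fst r) \<in> R) \<and>
     (\<forall>i\<in>snd r. \<forall>j\<in>snd r. i \<noteq> j \<longrightarrow> unjoined f n i j) \<and>
     (n < 6 \<longrightarrow> r = (base n, initial_nbrs n)) \<and>
     (\<forall>i k. 6 \<le> n \<longrightarrow> task n = (i, k) \<longrightarrow> i < n \<longrightarrow> even i \<noteq> even n \<longrightarrow>
        (if i \<noteq> k \<and> k < n \<and> even k = even i \<and> unjoined f n i k
         then snd r = {i, k} else r = (D (fst (f i)) k, {i})))"

text \<open>Choosing \<open>f\<close> by well-founded recursion allows a stage to consult
  \<open>f\<close> only below \<open>n\<close>; members of \<open>snd r\<close> are below
  \<open>n\<close> by the second clause.\<close>

lemma admissible_cong: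
  assumes "\<And>z. z < n \<Longrightarrow> f z = g z"
  shows "admissible f n r \<longleftrightarrow> admissible g n r"
proof -
  have u: "unjoined f n i k \<longleftrightarrow> unjoined g n i k" if "i < n" "k < n" for i k
    using that assms by (auto simp: unjoined_def earlier_adj_def)
  have "(\<forall>j\<in>snd r. j < n \<and> even j \<noteq> even n \<and> (fst (f j), fst r) \<in> R) \<longleftrightarrow>
        (\<forall>j\<in>snd r. j < n \<and> even j \<noteq> even n \<and> (fst (g j), fst r) \<in> R)"
    using assms by auto
  moreover have "(\<forall>i\<in>snd r. \<forall>j\<in>snd r. i \<noteq> j \<longrightarrow> unjoined f n i j) \<longleftrightarrow>
      (\<forall>i\<in>snd r. \<forall>j\<in>snd r. i \<noteq> j \<longrightarrow> unjoined g n i j)" if "\<forall>j\<in>snd r. j < n"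
    using u that by blast
  moreover have "(if i \<noteq> k \<and> k < n \<and> even k = even i \<and> unjoined f n i k
         then snd r = {i, k} else r = (D (fst (f i)) k, {i})) \<longleftrightarrow>
      (if i \<noteq> k \<and> k < n \<and> even k = even i \<and> unjoined g n i k
         then snd r = {i, k} else r = (D (fst (g i)) k, {i}))" if "i < n" for i k
    using u[of i k] assms[of i] that by auto
  ultimately show ?thesis
    unfolding admissible_def by (smt (verit, best))
qed

section \<open>Every stage can be carried out\<close>

lemma base_adj: "even i \<noteq> even n \<Longrightarrow> (base n, base i) \<in> R"
  using w01 sym by (auto simp: base_def)

lemma base_refl: "\<exists>x. (base n, x) \<in> R \<and> (x, base n) \<in> R"
proof (intro exI conjI)
  show "(base n, base (Suc n)) \<in> R" "(base (Suc n), base n) \<in> R"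
    by (rule base_adj, simp)+
qed

text \<open>The path \<open>base n\<close>, \<open>base i\<close>, \<open>x\<close>,
  \<open>w\<close>, \<open>v\<close> has length four and shrinks to length two by
  \<open>four\<close>.\<close>

lemma base_step:
  assumes "\<exists>x. (base i, x) \<in> R \<and> (x, w) \<in> R" "even i \<noteq> even n" "(w, v) \<in> R"
  shows "\<exists>x. (base n, x) \<in> R \<and> (x, v) \<in> R"
proof -
  obtain x where "(base i, x) \<in> R" "(x, w) \<in> R" using assms(1) by blast
  then show ?thesis using four[OF base_adj] assms(2,3) by blast
qed

lemma admissible_extend:
  assumes IH: "\<And>y. y < n \<Longrightarrow> admissible f y (f y)"
  shows "\<exists>r. admissible f n r"
proof -
  have cls: "\<exists>x. (base y, x) \<in> R \<and> (x, fst (f y)) \<in> R" if "y < n" for y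
    using IH[OF that] unfolding admissible_def by blast
  obtain i k where t: "task n = (i, k)" by fastforce
  consider (init) "n < 6" | (idle) "6 \<le> n" "\<not> (i < n \<and> even i \<noteq> even n)"
    | (join) "6 \<le> n" "i < n" "even i \<noteq> even n" "i \<noteq> k \<and> k < n \<and> even k = even i \<and> unjoined f n i k"
    | (wit) "6 \<le> n" "i < n" "even i \<noteq> even n"
        "\<not> (i \<noteq> k \<and> k < n \<and> even k = even i \<and> unjoined f n i k)"
    by linarith
  then show ?thesis
  proof cases
    case init
    have "f y = (base y, initial_nbrs y)" if "y < n" for y
      using IH[OF that] init that by (auto simp: admissible_def)
    then have "j < n \<and> even j \<noteq> even n \<and> (fst (f j), base n) \<in> R" if "j \<in> initial_nbrs n" for j
      using that base_adj[of n j] by (auto simp: initial_nbrs_def split: if_splits)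
    moreover have "\<forall>i\<in>initial_nbrs n. \<forall>j\<in>initial_nbrs n. i = j"
      by (auto simp: initial_nbrs_def)
    ultimately have "admissible f n (base n, initial_nbrs n)"
      using init base_refl[of n] by (auto simp: admissible_def)
    then show ?thesis ..
  next
    case idle
    then have "admissible f n (base n, {})"
      using base_refl[of n] t by (auto simp: admissible_def)
    then show ?thesis ..
  next
    case join
    \<comment> \<open>Equal parity makes \<open>base k\<close> equal to \<open>base i\<close>, so a
      path of length four through \<open>base i\<close> connects the labels of \<open>i\<close> and
      \<open>k\<close>, and \<open>four\<close> yields the new label \<open>v\<close>.\<close>
    from cls[of i] cls[of k] join obtain x y where
      "(fst (f i), x) \<in> R" "(x, base i) \<in> R" "(base i, y) \<in> R" "(y, fst (f k)) \<in> R"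
      by (metis base_def sym)
    then obtain v where v: "(fst (f i), v) \<in> R" "(v, fst (f k)) \<in> R" using four by blast
    have "unjoined f n k i" using join by (auto simp: unjoined_def)
    moreover have "\<exists>x. (base n, x) \<in> R \<and> (x, v) \<in> R"
      using base_step cls join v by blast
    ultimately have "admissible f n (v, {i, k})"
      using join t v sym by (auto simp: admissible_def)
    then show ?thesis ..
  next
    case wit
    \<comment> \<open>The class invariant gives the label of \<open>i\<close> some
      \<open>R\<close>-neighbour, as the law for \<open>D\<close> demands.\<close>
    have "(fst (f i), D (fst (f i)) k) \<in> R" using cls[OF wit(2)] D sym by blast
    moreover from this have "\<exists>x. (base n, x) \<in> R \<and> (x, D (fst (f i)) k) \<in> R"
      using base_step cls wit by blast
    ultimately have "admissible f n (D (fst (f i)) k, {i})"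
      using wit t by (auto simp: admissible_def)
    then show ?thesis ..
  qed
qed

lemma admissible_sequence: "\<exists>f. \<forall>n. admissible f n (f n)"
proof (rule dependent_wellorder_choice)
  show "admissible f n r = admissible g n r" if "\<And>y. y < n \<Longrightarrow> f y = g y" for r f g n
    using that by (rule admissible_cong)
  show "\<exists>r. admissible f n r" if "\<And>y. y < n \<Longrightarrow> admissible f y (f y)" for n f
    using that by (rule admissible_extend)
qed

section \<open>The plane obtained in the limit\<close>

theorem exists_labelled_plane:
  "\<exists>(I :: nat rel) l. one_plane UNIV I \<and> projective UNIV I \<and> nondegenerate I \<and> l 0 = w0 \<and>
     (\<forall>i j. (i, j) \<in> I \<longrightarrow> (l i, l j) \<in> R) \<and> (\<forall>i k. \<exists>j. (i, j) \<in> I \<and> l j = D (l i) k)"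
proof -
  obtain f where f: "\<And>n. admissible f n (f n)" using admissible_sequence by blast
  define I where "I = {(i, j). earlier_adj f i j}"
  define l where "l = fst \<circ> f"
  have nbr: "j < n \<and> even j \<noteq> even n \<and> (l j, l n) \<in> R" if "j \<in> snd (f n)" for j n
    using f[of n] that by (auto simp: admissible_def l_def)
  have I_sym: "(j, i) \<in> I" if "(i, j) \<in> I" for i j
    using that by (auto simp: I_def earlier_adj_def)
  have I_lab: "(l i, l j) \<in> R" and I_par: "even i \<noteq> even j" if "(i, j) \<in> I" for i j
    using that nbr sym unfolding I_def earlier_adj_def by blast+
  have init: "f n = (base n, initial_nbrs n)" if "n < 6" for n
    using f[of n] that by (auto simp: admissible_def)
  have step: "if i \<noteq> k \<and> k < n \<and> even k = even i \<and> unjoined f n i k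
      then snd (f n) = {i, k} else f n = (D (l i) k, {i})"
    if "6 \<le> n" "i < n" "even i \<noteq> even n" "task n = (i, k)" for n i k
    using f[of n] that unfolding admissible_def l_def comp_def by blast
  have joined: "\<exists>m. (i, m) \<in> I \<and> (m, k) \<in> I" if "i \<noteq> k" "even i = even k" for i k
  proof -
    \<comment> \<open>A late stage of the opposite parity serves the pair: either the new vertex
      \<open>n\<close> joins it, or a common neighbour was there before.\<close>
    obtain n where n: "n > max 6 (max i k)" "even n = odd i" "task n = (i, k)"
      using task_unbounded by blast
    show ?thesis
    proof (cases "unjoined f n i k")
      case True
      then have "snd (f n) = {i, k}" using step[of n i k] n that by auto
      then show ?thesis by (auto simp: I_def earlier_adj_def)
    next
      case False
      then show ?thesis by (auto simp: unjoined_def I_def earlier_adj_def)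
    qed
  qed
  have witness: "\<exists>j. (i, j) \<in> I \<and> l j = D (l i) k" for i k
  proof -
    \<comment> \<open>Beyond a possible common neighbour \<open>m\<close> of \<open>i\<close> and
      \<open>k\<close> the joining test fails, so stage \<open>n\<close> must attach a
      witness.\<close>
    obtain m where m: "i \<noteq> k \<Longrightarrow> even i = even k \<Longrightarrow> (i, m) \<in> I \<and> (m, k) \<in> I"
      using joined by blast
    obtain n where n: "n > max (max 6 m) (max i k)" "even n = odd i" "task n = (i, k)"
      using task_unbounded by blast
    have "\<not> (i \<noteq> k \<and> k < n \<and> even k = even i \<and> unjoined f n i k)"
      using m n unfolding unjoined_def I_def by (auto simp: earlier_adj_sym)
    then have "f n = (D (l i) k, {i})" using step[of n i k] n by auto
    then show ?thesis by (intro exI[of _ n]) (auto simp: I_def earlier_adj_def l_def)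
  qed
  have p2: "I ^^ 2 = I O I" and p3: "I ^^ 3 = I O I O I" and p4: "I ^^ 4 = I O I O I O I"
    by (simp_all add: numeral_eq_Suc O_assoc)
  have I2: "(a, b) \<in> I ^^ 2 \<longleftrightarrow> even a = even b" for a b
  proof
    assume "(a, b) \<in> I ^^ 2" then show "even a = even b" using I_par unfolding p2 by blast
  next
    assume "even a = even b"
    then show "(a, b) \<in> I ^^ 2"
      using joined[of a b] witness[of a] I_sym unfolding p2 by (cases "a = b") blast+
  qed
  have I3: "(a, b) \<in> I ^^ 3" if "even a \<noteq> even b" for a b
  proof -
    obtain c where c: "(c, b) \<in> I" using witness I_sym by blast
    then have "(a, c) \<in> I ^^ 2" using that I_par I2 by blast
    then show ?thesis using c unfolding p2 p3 by blast
  qed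
  \<comment> \<open>The largest vertex \<open>a\<close> of a 4-cycle would have been attached to
    both \<open>b\<close> and \<open>d\<close>, although \<open>c < a\<close> already joined
    them.\<close>
  have top: "b = d" if "(a, b) \<in> I" "(b, c) \<in> I" "(c, d) \<in> I" "(d, a) \<in> I"
    "b < a" "c < a" "d < a" for a b c d
  proof (rule ccontr)
    assume "b \<noteq> d"
    have "b \<in> snd (f a)" "d \<in> snd (f a)"
      using that nbr[of a b] nbr[of a d] by (auto simp: I_def earlier_adj_def)
    then have "unjoined f a b d" using f[of a] \<open>b \<noteq> d\<close> by (auto simp: admissible_def)
    then show False using that by (auto simp: unjoined_def I_def earlier_adj_sym)
  qed
  have cyc: "a = c \<or> b = d" if "(a, b) \<in> I" "(b, c) \<in> I" "(c, d) \<in> I" "(d, a) \<in> I" for a b c d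
  proof (rule ccontr)
    assume n: "\<not> (a = c \<or> b = d)"
    moreover have "a \<noteq> b" "b \<noteq> c" "c \<noteq> d" "d \<noteq> a" using that I_par by blast+
    \<comment> \<open>The four vertices are distinct, so one is strictly largest, and a rotation of
      the cycle fits \<open>top\<close>.\<close>
    ultimately consider "b < a" "c < a" "d < a" | "a < b" "c < b" "d < b"
      | "a < c" "b < c" "d < c" | "a < d" "b < d" "c < d"
      by (metis linorder_neqE_nat order.strict_trans)
    then show False
      using n top[of a b c d] top[of b c d a] top[of c d a b] top[of d a b c] that by cases auto
  qed
  have "one_plane UNIV I"
    unfolding one_plane_def frame_def
  proof (intro conjI allI impI ballI)
    fix a b assume "(a, b) \<in> I ^^ 4"
    then have "even a = even b" using I_par unfolding p4 by blast
    then show "(a, b) \<in> I ^^ 2" by (simp only: I2)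
  qed (use I2 I3 cyc in auto)
  moreover have "projective UNIV I"
  proof -
    have cl: "(I ^^ 2) `` {a} = {b. even b = even a}" for a using I2 by auto
    have "UNIV // (I ^^ 2) = {{b. even b}, {b. odd b}}"
    proof
      show "UNIV // (I ^^ 2) \<subseteq> {{b. even b}, {b. odd b}}"
        unfolding quotient_def cl by auto
      have "(I ^^ 2) `` {0} = {b. even b}" "(I ^^ 2) `` {1} = {b. odd b}" by (auto simp: cl)
      then show "{{b. even b}, {b. odd b}} \<subseteq> UNIV // (I ^^ 2)"
        by (metis (no_types, lifting) UNIV_I empty_subsetI insert_subset quotientI)
    qed
    moreover have "{b::nat. even b} \<noteq> {b. odd b}" by blast
    ultimately show ?thesis by (simp add: projective_def)
  qed
  moreover have "nondegenerate I"
    unfolding nondegenerate_def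
    by (rule exI[of _ 0], rule exI[of _ 1], rule exI[of _ 2], rule exI[of _ 3],
        rule exI[of _ 4], rule exI[of _ 5])
       (simp add: I_def earlier_adj_def init initial_nbrs_def)
  moreover have "l 0 = w0" by (simp add: l_def init base_def)
  ultimately show ?thesis using I_lab witness by blast
qed

end

section \<open>The canonical frame\<close>

instance fm :: countable by countable_datatype

abbreviation bot :: fm where "bot \<equiv> And (Var 0) (Neg (Var 0))"

section \<open>Theories over 12g\<close>

lemma normal_logic_12g: "normal_logic logic_12g"
  unfolding normal_logic_def
proof (intro conjI allI impI)
  fix p q assume *: "Imp p q \<in> logic_12g" "p \<in> logic_12g"
  show "q \<in> logic_12g"
    unfolding logic_12g_def
  proof (rule InterI)
    fix L assume L: "L \<in> {L. normal_logic L \<and>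
      (\<forall>p. Imp (Box p) (Dia p) \<in> L) \<and>
      (\<forall>p. Imp (Dia (Box p)) p \<in> L) \<and>
      (\<forall>p. Imp (Box (Box p)) (Box (Box (Box (Box p)))) \<in> L)}"
    have "Imp p q \<in> L" "p \<in> L"
      using *[unfolded logic_12g_def, THEN InterD, OF L] .
    then show "q \<in> L" using L unfolding normal_logic_def by simp
  qed
qed (simp_all add: logic_12g_def normal_logic_def)

lemma logic_12g_taut: "tautology p \<Longrightarrow> p \<in> logic_12g"
  and logic_12g_K: "Imp (Box (Imp p q)) (Imp (Box p) (Box q)) \<in> logic_12g"
  and logic_12g_mp: "Imp p q \<in> logic_12g \<Longrightarrow> p \<in> logic_12g \<Longrightarrow> q \<in> logic_12g"
  and logic_12g_nec: "p \<in> logic_12g \<Longrightarrow> Box p \<in> logic_12g"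
  using normal_logic_12g unfolding normal_logic_def by iprover+

lemma logic_12g_D: "Imp (Box p) (Dia p) \<in> logic_12g"
  and logic_12g_B: "Imp (Dia (Box p)) p \<in> logic_12g"
  and logic_12g_4: "Imp (Box (Box p)) (Box (Box (Box (Box p)))) \<in> logic_12g"
  by (simp_all add: logic_12g_def)

text \<open>The formulas true in the model on a single reflexive point form a normal logic.\<close>

lemma bot_notin_logic_12g: "bot \<notin> logic_12g"
proof -
  let ?T = "true_at {(0::nat, 0)} (\<lambda>_. {}) 0"
  have "bool_eval ?T p = ?T p" for p by (induction p) auto
  then have "normal_logic {p. ?T p}"
    by (auto simp: normal_logic_def tautology_def)
  then have "logic_12g \<subseteq> {p. ?T p}" unfolding logic_12g_def by (intro Inter_lower) auto
  then show ?thesis by auto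
qed

text \<open>Necessitation is left out, as it does not preserve truth at a single point.\<close>

definition is_theory :: "fm set \<Rightarrow> bool" where
  "is_theory T \<longleftrightarrow> logic_12g \<subseteq> T \<and> (\<forall>p q. Imp p q \<in> T \<longrightarrow> p \<in> T \<longrightarrow> q \<in> T)"

lemma theory_mp: "is_theory T \<Longrightarrow> Imp p q \<in> T \<Longrightarrow> p \<in> T \<Longrightarrow> q \<in> T"
  unfolding is_theory_def by blast

lemma theory_logic: "is_theory T \<Longrightarrow> p \<in> logic_12g \<Longrightarrow> p \<in> T"
  unfolding is_theory_def by blast

lemma theory_taut: "is_theory T \<Longrightarrow> tautology p \<Longrightarrow> p \<in> T"
  by (rule theory_logic[OF _ logic_12g_taut])

lemma theory_taut1: "is_theory T \<Longrightarrow> p \<in> T \<Longrightarrow> tautology (Imp p q) \<Longrightarrow> q \<in> T"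
  by (rule theory_mp[OF _ theory_taut])

lemma theory_taut2:
  "is_theory T \<Longrightarrow> p \<in> T \<Longrightarrow> q \<in> T \<Longrightarrow> tautology (Imp p (Imp q r)) \<Longrightarrow> r \<in> T"
  by (rule theory_mp[OF _ theory_mp[OF _ theory_taut]])

lemma is_theory_logic: "is_theory logic_12g"
  by (simp only: is_theory_def subset_refl simp_thms) (iprover intro: logic_12g_mp)

lemma logic_12g_box_mono:
  assumes "Imp p q \<in> logic_12g"
  shows "Imp (Box p) (Box q) \<in> logic_12g"
  by (rule logic_12g_mp[OF logic_12g_K logic_12g_nec[OF assms]])

lemma is_theory_unbox:
  assumes "is_theory T"
  shows "is_theory {p. Box p \<in> T}"
  unfolding is_theory_def
proof (intro conjI subsetI allI impI; simp)
  fix p assume "p \<in> logic_12g"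
  then show "Box p \<in> T" by (rule theory_logic[OF assms logic_12g_nec])
next
  fix p q assume "Box (Imp p q) \<in> T" "Box p \<in> T"
  then show "Box q \<in> T"
    by (rule theory_mp[OF assms theory_mp[OF assms theory_logic[OF assms logic_12g_K]]])
qed

text \<open>The theory generated by \<open>S\<close> and \<open>T\<close>; a single premise
  \<open>q\<close> suffices because \<open>T\<close> is closed under conjunction.\<close>

lemma is_theory_join:
  assumes S: "is_theory S" and T: "is_theory T"
  shows "is_theory {r. \<exists>q\<in>T. Imp q r \<in> S}" (is "is_theory ?J")
    and "S \<subseteq> {r. \<exists>q\<in>T. Imp q r \<in> S}" and "T \<subseteq> {r. \<exists>q\<in>T. Imp q r \<in> S}"
proof -
  show "T \<subseteq> ?J"
  proof
    fix q assume "q \<in> T"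
    moreover have "Imp q q \<in> S" by (rule theory_taut[OF S]) (simp add: tautology_def)
    ultimately show "q \<in> ?J" by blast
  qed
  show SJ: "S \<subseteq> ?J"
  proof
    fix r assume "r \<in> S"
    then have "Imp (Neg bot) r \<in> S" by (rule theory_taut1[OF S]) (simp add: tautology_def)
    moreover have "Neg bot \<in> T" by (rule theory_taut[OF T]) (simp add: tautology_def)
    ultimately show "r \<in> ?J" by blast
  qed
  have "r \<in> ?J" if "Imp p r \<in> ?J" "p \<in> ?J" for p r
  proof -
    from that obtain q q' where q: "q \<in> T" "Imp q (Imp p r) \<in> S" "q' \<in> T" "Imp q' p \<in> S"
      by blast
    have "And q q' \<in> T" by (rule theory_taut2[OF T q(1,3)]) (simp add: tautology_def)
    moreover have "Imp (And q q') r \<in> S"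
      by (rule theory_taut2[OF S q(2,4)]) (auto simp: tautology_def)
    ultimately show ?thesis by blast
  qed
  moreover have "logic_12g \<subseteq> ?J" using SJ S by (auto simp: is_theory_def)
  ultimately show "is_theory ?J" unfolding is_theory_def by blast
qed

text \<open>A form of the deduction theorem: this is the theory generated by \<open>T\<close> and
  \<open>p\<close>.\<close>

lemma is_theory_insert:
  assumes T: "is_theory T"
  shows "is_theory {q. Imp p q \<in> T}"
  unfolding is_theory_def
proof (intro conjI subsetI allI impI; simp)
  fix q assume "q \<in> logic_12g"
  then have "q \<in> T" by (rule theory_logic[OF T])
  then show "Imp p q \<in> T" by (rule theory_taut1[OF T]) (simp add: tautology_def)
next
  fix q r assume "Imp p (Imp q r) \<in> T" "Imp p q \<in> T"
  then show "Imp p r \<in> T" by (rule theory_taut2[OF T]) (auto simp: tautology_def)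
qed

section \<open>Maximal consistent sets\<close>

definition mcs :: "fm set \<Rightarrow> bool" where
  "mcs w \<longleftrightarrow> is_theory w \<and> (\<forall>p. Neg p \<in> w \<longleftrightarrow> p \<notin> w)"

lemma lindenbaum:
  assumes T: "is_theory T" "bot \<notin> T"
  shows "\<exists>w. mcs w \<and> T \<subseteq> w"
proof -
  let ?A = "{S. is_theory S \<and> bot \<notin> S \<and> T \<subseteq> S}"
  have "\<exists>M\<in>?A. \<forall>S\<in>?A. M \<subseteq> S \<longrightarrow> S = M"
  proof (rule subset_Zorn_nonempty)
    show "?A \<noteq> {}" using T by blast
    fix C assume C: "C \<noteq> {}" "subset.chain ?A C"
    then have A: "C \<subseteq> ?A" and ch: "\<And>x y. x \<in> C \<Longrightarrow> y \<in> C \<Longrightarrow> x \<subseteq> y \<or> y \<subseteq> x"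
      unfolding subset_chain_def by auto
    have "is_theory (\<Union>C)"
      unfolding is_theory_def
    proof (intro conjI allI impI)
      show "logic_12g \<subseteq> \<Union>C" using C(1) A theory_logic by blast
      fix p q assume "Imp p q \<in> \<Union>C" "p \<in> \<Union>C"
      then obtain S where "S \<in> C" "Imp p q \<in> S" "p \<in> S" using ch by blast
      then show "q \<in> \<Union>C" using A theory_mp by blast
    qed
    then show "\<Union>C \<in> ?A" using C(1) A by blast
  qed
  then obtain w where M: "w \<in> ?A" "\<forall>S\<in>?A. w \<subseteq> S \<longrightarrow> S = w" by (rule bexE)
  from M(1) have w: "is_theory w" "bot \<notin> w" "T \<subseteq> w" by auto
  have max: "S = w" if "is_theory S" "bot \<notin> S" "w \<subseteq> S" for S
    using M(2) w(3) that by auto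
  have "Neg p \<in> w \<longleftrightarrow> p \<notin> w" for p
  proof
    assume n: "Neg p \<in> w"
    show "p \<notin> w"
    proof
      assume "p \<in> w"
      with n have "bot \<in> w" by (rule theory_taut2[OF w(1)]) (simp add: tautology_def)
      then show False using w(2) by blast
    qed
  next
    assume p: "p \<notin> w"
    have "w \<subseteq> {q. Imp p q \<in> w}"
    proof
      fix q assume "q \<in> w"
      then have "Imp p q \<in> w" by (rule theory_taut1[OF w(1)]) (simp add: tautology_def)
      then show "q \<in> {q. Imp p q \<in> w}" by blast
    qed
    moreover have "Imp p p \<in> w" by (rule theory_taut[OF w(1)]) (simp add: tautology_def)
    \<comment> \<open>Otherwise maximality would identify this theory with \<open>w\<close>, though
      it contains \<open>p\<close>.\<close>
    ultimately have "bot \<in> {q. Imp p q \<in> w}"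
      using max[OF is_theory_insert[OF w(1), of p]] p by blast
    then have "Imp p bot \<in> w" by blast
    then show "Neg p \<in> w" by (rule theory_taut1[OF w(1)]) (auto simp: tautology_def)
  qed
  then show ?thesis using w by (auto simp: mcs_def)
qed

lemma mcs_theory: "mcs w \<Longrightarrow> is_theory w"
  and mcs_neg: "mcs w \<Longrightarrow> Neg p \<in> w \<longleftrightarrow> p \<notin> w"
  by (auto simp: mcs_def)

lemma mcs_and:
  assumes "mcs w"
  shows "And p q \<in> w \<longleftrightarrow> p \<in> w \<and> q \<in> w"
proof (intro iffI conjI; (elim conjE)?)
  note T = mcs_theory[OF assms]
  show "p \<in> w" "q \<in> w" if "And p q \<in> w"
    by (rule theory_taut1[OF T that], simp add: tautology_def)+
  show "And p q \<in> w" if "p \<in> w" "q \<in> w"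
    by (rule theory_taut2[OF T that]) (simp add: tautology_def)
qed

lemma mcs_imp: "mcs w \<Longrightarrow> Imp p q \<in> logic_12g \<Longrightarrow> p \<in> w \<Longrightarrow> q \<in> w"
  by (rule theory_mp[OF mcs_theory theory_logic[OF mcs_theory]])

section \<open>The canonical relation\<close>

definition canonical :: "fm set rel" where
  "canonical = {(w, v). mcs w \<and> mcs v \<and> (\<forall>p. Box p \<in> w \<longrightarrow> p \<in> v)}"

text \<open>Unboxing \<open>w\<close> and adding \<open>Neg p\<close> generates a theory without
  \<open>bot\<close>, since otherwise \<open>Box p\<close> would lie in \<open>w\<close>; a maximal
  extension is the required \<open>v\<close>.\<close>

lemma canonical_witness:
  assumes "mcs w" "Box p \<notin> w"
  shows "\<exists>v. (w, v) \<in> canonical \<and> p \<notin> v"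
proof -
  let ?T = "{q. Box q \<in> w}" and ?S = "{q. Imp (Neg p) q \<in> {q. Box q \<in> w}}"
  have T: "is_theory ?T" by (intro is_theory_unbox mcs_theory assms)
  have "bot \<notin> ?S"
  proof
    assume "bot \<in> ?S"
    then have "Imp (Neg p) bot \<in> ?T" by blast
    then have "p \<in> ?T" by (rule theory_taut1[OF T]) (auto simp: tautology_def)
    then show False using assms by blast
  qed
  then obtain v where v: "mcs v" "?S \<subseteq> v" using lindenbaum[OF is_theory_insert[OF T]] by blast
  have "Imp (Neg p) (Neg p) \<in> ?T" by (rule theory_taut[OF T]) (simp add: tautology_def)
  then have "p \<notin> v" using v mcs_neg by blast
  moreover have "q \<in> v" if "Box q \<in> w" for q
  proof -
    have "q \<in> ?T" using that by blast
    then have "Imp (Neg p) q \<in> ?T" by (rule theory_taut1[OF T]) (auto simp: tautology_def)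
    then show ?thesis using v by blast
  qed
  ultimately show ?thesis using assms v by (auto simp: canonical_def)
qed

text \<open>\<open>Box bot\<close> in \<open>w\<close> would bring in \<open>Dia bot\<close>,
  against \<open>Box (Neg bot)\<close>. The witness for the failure of \<open>Box bot\<close> is a
  successor.\<close>

lemma canonical_serial:
  assumes "mcs w"
  shows "\<exists>v. (w, v) \<in> canonical"
proof -
  have "Neg bot \<in> logic_12g" by (rule logic_12g_taut) (simp add: tautology_def)
  then have "Box (Neg bot) \<in> w"
    using theory_logic[OF mcs_theory[OF assms] logic_12g_nec] by blast
  then have "Box bot \<notin> w" using mcs_imp[OF assms logic_12g_D, of bot] mcs_neg[OF assms] by blast
  then show ?thesis using canonical_witness assms by blast
qed

lemma canonical_sym:
  assumes "(w, v) \<in> canonical"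
  shows "(v, w) \<in> canonical"
proof -
  have m: "mcs w" "mcs v" and b: "\<And>p. Box p \<in> w \<Longrightarrow> p \<in> v"
    using assms by (auto simp: canonical_def)
  have "p \<in> w" if "Box p \<in> v" for p
  proof -
    have "Neg (Box p) \<notin> v" using that m mcs_neg by blast
    then have "Dia (Box p) \<in> w" using b m mcs_neg by blast
    then show ?thesis using mcs_imp[OF m(1) logic_12g_B] by blast
  qed
  then show ?thesis using m by (auto simp: canonical_def)
qed

text \<open>The contrapositive of the symmetry axiom, ready for use under a box.\<close>

lemma logic_12g_B': "Imp (Neg p) (Box (Neg (Box p))) \<in> logic_12g"
  by (rule theory_taut1[OF is_theory_logic logic_12g_B[of p]]) (auto simp: tautology_def)

text \<open>By symmetry a common successor \<open>x\<close> of \<open>a\<close> and \<open>e\<close>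
  is enough. If unboxing \<open>a\<close> and \<open>e\<close> gave incompatible theories, some
  \<open>Box q\<close> in \<open>e\<close> would meet \<open>Box (Neg q)\<close> in
  \<open>a\<close>; then \<open>Neg (Box q)\<close> is boxed twice in \<open>a\<close>, hence four
  times, and the path carries it to \<open>e\<close>.\<close>

lemma canonical_four:
  assumes "(a, b) \<in> canonical" "(b, c) \<in> canonical" "(c, d) \<in> canonical" "(d, e) \<in> canonical"
  shows "\<exists>x. (a, x) \<in> canonical \<and> (x, e) \<in> canonical"
proof -
  have m: "mcs a" "mcs e" using assms by (auto simp: canonical_def)
  let ?S = "{q. Box q \<in> a}" and ?T = "{q. Box q \<in> e}"
  have ST: "is_theory ?S" "is_theory ?T" using is_theory_unbox mcs_theory m by blast+
  note J = is_theory_join[OF ST]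
  have "bot \<notin> {r. \<exists>q\<in>?T. Imp q r \<in> ?S}"
  proof
    assume "bot \<in> {r. \<exists>q\<in>?T. Imp q r \<in> ?S}"
    then obtain q where q: "Box q \<in> e" and "Imp q bot \<in> ?S" by blast
    from this(2) have "Neg q \<in> ?S" by (rule theory_taut1[OF ST(1)]) (auto simp: tautology_def)
    then have "Box (Box (Neg (Box q))) \<in> a"
      using mcs_imp[OF m(1) logic_12g_box_mono[OF logic_12g_B']] by blast
    then have "Box (Box (Box (Box (Neg (Box q))))) \<in> a"
      using mcs_imp[OF m(1) logic_12g_4] by blast
    then have "Neg (Box q) \<in> e" using assms unfolding canonical_def by blast
    then show False using q mcs_neg[OF m(2)] by blast
  qed
  then obtain x where x: "mcs x" "{r. \<exists>q\<in>?T. Imp q r \<in> ?S} \<subseteq> x"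
    using lindenbaum[OF J(1)] by blast
  then have "(a, x) \<in> canonical" "(e, x) \<in> canonical"
    using J(2,3) m unfolding canonical_def by blast+
  then show ?thesis using canonical_sym by blast
qed

lemma consistent_extends_mcs:
  assumes "consistent logic_12g \<Sigma>"
  shows "\<exists>w. mcs w \<and> \<Sigma> \<subseteq> w"
\<comment> \<open>Conjunctions are nonempty, so an empty \<Sigma> has none and the set
  \<open>?T\<close> below would be empty.\<close>
proof (cases "\<Sigma> = {}")
  case True
  then show ?thesis using lindenbaum[OF is_theory_logic bot_notin_logic_12g] by blast
next
  case False
  let ?T = "{q. \<exists>p\<in>conjunctions \<Sigma>. Imp p q \<in> logic_12g}"
  note L = is_theory_logic
  have "is_theory ?T"
    unfolding is_theory_def
  proof (intro conjI subsetI allI impI)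
    fix q assume q: "q \<in> logic_12g"
    obtain s where "s \<in> \<Sigma>" using False by blast
    moreover have "Imp s q \<in> logic_12g"
      by (rule theory_taut1[OF L q]) (simp add: tautology_def)
    ultimately show "q \<in> ?T" using conjunctions.member by blast
  next
    fix q r assume "Imp q r \<in> ?T" "q \<in> ?T"
    then obtain a b where ab: "a \<in> conjunctions \<Sigma>" "b \<in> conjunctions \<Sigma>"
      "Imp a (Imp q r) \<in> logic_12g" "Imp b q \<in> logic_12g" by blast
    have "Imp (And a b) r \<in> logic_12g"
      by (rule theory_taut2[OF L ab(3,4)]) (auto simp: tautology_def)
    then show "r \<in> ?T" using conjunctions.conj[OF ab(1,2)] by blast
  qed
  moreover have "bot \<notin> ?T"
  proof
    assume "bot \<in> ?T"
    then obtain p where p: "p \<in> conjunctions \<Sigma>" "Imp p bot \<in> logic_12g" by blast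
    have "Neg p \<in> logic_12g" by (rule theory_taut1[OF L p(2)]) (auto simp: tautology_def)
    then show False using assms p(1) by (auto simp: consistent_def)
  qed
  ultimately obtain w where w: "mcs w" "?T \<subseteq> w" using lindenbaum by blast
  have "p \<in> ?T" if "p \<in> \<Sigma>" for p
    using conjunctions.member[OF that] logic_12g_taut[of "Imp p p"] by (auto simp: tautology_def)
  then show ?thesis using w by blast
qed

theorem theorem6p1:
  fixes \<Sigma> :: "fm set"
  assumes "consistent logic_12g \<Sigma>"
  shows "\<exists>(X :: nat set) I V. one_plane X I \<and> projective X I \<and> nondegenerate I \<and>
           valuation X V \<and> satisfiable_in X I V \<Sigma>"
proof -
  obtain w0 where w0: "mcs w0" "\<Sigma> \<subseteq> w0" using consistent_extends_mcs[OF assms] by blast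
  obtain w1 where w1: "(w0, w1) \<in> canonical" using canonical_serial w0 by blast
  \<comment> \<open>One choice function serves two purposes: \<open>W w p\<close> omits
    \<open>p\<close> when \<open>Box p\<close> is missing from \<open>w\<close>, and is an arbitrary
    successor otherwise.\<close>
  have "\<exists>v. mcs w \<longrightarrow> (w, v) \<in> canonical \<and> (Box p \<notin> w \<longrightarrow> p \<notin> v)" for w p
    using canonical_witness canonical_serial by blast
  then obtain W where W:
    "\<And>w p. mcs w \<Longrightarrow> (w, W w p) \<in> canonical \<and> (Box p \<notin> w \<longrightarrow> p \<notin> W w p)" by metis
  \<comment> \<open>\<open>from_nat\<close> reads every index as a formula; \<open>to_nat\<close>
    supplies the index of the wanted one.\<close>
  interpret labelled_plane canonical "\<lambda>w k. W w (from_nat k)" w0 w1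
  proof
    show "(w, W w (from_nat k)) \<in> canonical" if "(w, v) \<in> canonical" for w v k
      using that W by (auto simp: canonical_def)
  qed (use canonical_sym canonical_four w1 in blast)+
  obtain I :: "nat rel" and l where I: "one_plane UNIV I" "projective UNIV I" "nondegenerate I"
    "l 0 = w0" and lab: "\<And>i j. (i, j) \<in> I \<Longrightarrow> (l i, l j) \<in> canonical"
    and wit: "\<And>i k. \<exists>j. (i, j) \<in> I \<and> l j = W (l i) (from_nat k)"
    using exists_labelled_plane by blast
  let ?V = "\<lambda>n. {i. Var n \<in> l i}"
  \<comment> \<open>Every vertex is incident with some other, and \<open>canonical\<close> relates
    only maximal consistent sets.\<close>
  have m: "mcs (l i)" for i using wit[of i] lab by (auto simp: canonical_def)
  \<comment> \<open>For \<open>Box p\<close>, incidence respects \<open>canonical\<close>, which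
    carries \<open>p\<close> over; if \<open>Box p\<close> is missing, the vertex labelled
    \<open>W (l i) p\<close> refutes \<open>p\<close>.\<close>
  have "true_at I ?V i p \<longleftrightarrow> p \<in> l i" for i p
  proof (induction p arbitrary: i)
    case (Box p)
    show ?case
    proof (cases "Box p \<in> l i")
      case True
      then show ?thesis using lab Box unfolding canonical_def by fastforce
    next
      case False
      obtain j where "(i, j) \<in> I" "l j = W (l i) p" using wit[of i "to_nat p"] by auto
      then show ?thesis using False W[OF m] Box by auto
    qed
  qed (simp_all add: m mcs_neg mcs_and)
  then have "satisfiable_in UNIV I ?V \<Sigma>"
    using w0 I(4) unfolding satisfiable_in_def by blast
  then show ?thesis using I by (intro exI[of _ UNIV] exI[of _ I] exI[of _ ?V]) (auto simp: valuation_def)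
qed

end
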